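(* In online matching with online items and non-myopic offline agents with private graph edges, for every $\alpha<2$ there exists no randomized ex-ante truthful mechanism that yields an $\alpha$-approximation to the optimal social welfare. This is true even for tardy mechanisms.
   Context: Model. There is a bipartite graph $G=(B,I;E)$ with a set $B$ of $n$ buyers, known in advance, and a set $I$ of $m$ items arriving one by one in an unknown, possibly adversarial order (item $j$ arrives at time $j$). Buyer $i$ is interested in the items $j$ with $(i,j)\in E$, and has a value $v_i\ge 0$ for obtaining at least one item she is interested in (value $0$ otherwise). Private graph edges: both $v_i$ and the set of items $i$ is interested in are private information of $i$. When item $j$ arrives, every buyer declares whether she is interested in $j$ and, if so, a value; she may misreport both. All nonzero bids of buyer $i$ must equal a single value $b_i$ (a bid of $0$ meaning not interested). A mechanism, possibly randomized, decides upon the arrival of $j$, immediately and irrevocably and using only the bids on items up to $j$, either to assign $j$ to a buyer who declared interest in it and has not been assigned an item yet, or to leave $j$ unassigned forever. The result is a (random) matching $\mu$ ($\mu^{-1}_i$ is the item received by $i$, $\emptyset$ if none). The mechanism also charges non-negative payments $p_i$; it is tardy if payments are computed at the end of the whole process. Welfare. $\mathrm{SW}(\mu)=\sum_{i\in B} v_i\cdot \mathbb{I}[(i,\mu^{-1}_i)\in E]$, and the optimal social welfare is $\mathrm{OPT}=\mathrm{SW}(\mu^\star)$ where $\mu^\star$ is a maximum weight matching in $G$. A mechanism yields an $\alpha$-approximation if $\mathrm{OPT}\le\alpha\cdot \mathbb{E}[\mathrm{SW}(\mu)]$ on every instance (any numbers of buyers and items), with truthful reports. Ex-ante truthfulness.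 Non-myopic buyers know the whole sequence of items and have quasi-linear utility $u_i=v_i\cdot\mathbb{I}[(i,\mu_i^{-1})\in E]-p_i$. A mechanism is ex-ante truthful if, for every instance and every behavior of the other buyers, each agent maximizes her expected utility (over the mechanism's random choices) by reporting her value and her interests truthfully. Mechanisms are required to be ex-post individually rational: truthful agents have non-negative utility for every realization of the mechanism; in particular an agent who gets no item is not charged. *)

theory Defs
  imports "HOL-Probability.Probability"
begin

text \<open>
  Buyers are \<open>0, \<dots>, n - 1\<close> and items are \<open>0, \<dots>, m - 1\<close>, numbered by arrival time; \<open>(i, j) \<in> E\<close>
  means that buyer \<open>i\<close> is interested in item \<open>j\<close>.
\<close>

definition is_instance :: "nat \<Rightarrow> nat \<Rightarrow> (nat \<Rightarrow> real) \<Rightarrow> (nat \<times> nat) set \<Rightarrow> bool" where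
  "is_instance n m v E \<longleftrightarrow> (\<forall>i<n. 0 \<le> v i) \<and> E \<subseteq> {..<n} \<times> {..<m}"

text \<open>An assignment \<open>\<mu>\<close> maps each item to the buyer receiving it, or to \<^const>\<open>None\<close>.\<close>

type_synonym assignment = "nat \<Rightarrow> nat option"

definition satisfied :: "(nat \<times> nat) set \<Rightarrow> assignment \<Rightarrow> nat \<Rightarrow> bool" where
  "satisfied E \<mu> i \<longleftrightarrow> (\<exists>j. \<mu> j = Some i \<and> (i, j) \<in> E)"

definition welfare :: "nat \<Rightarrow> (nat \<Rightarrow> real) \<Rightarrow> (nat \<times> nat) set \<Rightarrow> assignment \<Rightarrow> real" where
  "welfare n v E \<mu> = (\<Sum>i<n. v i * of_bool (satisfied E \<mu> i))"

definition matchings :: "(nat \<times> nat) set \<Rightarrow> assignment set" where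
  "matchings E = {\<mu>. (\<forall>j i. \<mu> j = Some i \<longrightarrow> (i, j) \<in> E) \<and>
                     (\<forall>j j' i. \<mu> j = Some i \<longrightarrow> \<mu> j' = Some i \<longrightarrow> j = j')}"

definition opt :: "nat \<Rightarrow> (nat \<Rightarrow> real) \<Rightarrow> (nat \<times> nat) set \<Rightarrow> real" where
  "opt n v E = Max (welfare n v E ` matchings E)"

text \<open>The maximum in \<^const>\<open>opt\<close> is over a nonempty finite set.\<close>

lemma finite_matchings:
  assumes "finite E"
  shows "finite (matchings E)"
proof (rule finite_subset)
  show "matchings E \<subseteq> {\<mu>. \<forall>j. (j \<in> snd ` E \<longrightarrow> \<mu> j \<in> insert None (Some ` fst ` E)) \<and>
                             (j \<notin> snd ` E \<longrightarrow> \<mu> j = None)}"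
  proof
    fix \<mu> assume "\<mu> \<in> matchings E"
    then have *: "(i, j) \<in> E" if "\<mu> j = Some i" for i j
      using that by (auto simp: matchings_def)
    have "\<mu> j \<in> insert None (Some ` fst ` E) \<and> (j \<notin> snd ` E \<longrightarrow> \<mu> j = None)" for j
    proof (cases "\<mu> j")
      case (Some i)
      then have "(i, j) \<in> E" by (rule *)
      then show ?thesis using Some by force
    qed simp
    then show "\<mu> \<in> {\<mu>. \<forall>j. (j \<in> snd ` E \<longrightarrow> \<mu> j \<in> insert None (Some ` fst ` E)) \<and>
                             (j \<notin> snd ` E \<longrightarrow> \<mu> j = None)}"
      unfolding mem_Collect_eq by metis
  qed
qed (rule finite_set_of_finite_funs; use assms in simp)

lemma matchings_nonempty: "matchings E \<noteq> {}"
  by (auto simp: matchings_def intro: exI[of _ "\<lambda>_. None"])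

text \<open>
  A bid profile \<open>b\<close> has \<open>b i j\<close> as the bid of buyer \<open>i\<close> on item \<open>j\<close>, where \<open>0\<close> declares no interest.
\<close>

type_synonym bids = "nat \<Rightarrow> nat \<Rightarrow> real"

definition admissible_bid :: "nat \<Rightarrow> (nat \<Rightarrow> real) \<Rightarrow> bool" where
  "admissible_bid m r \<longleftrightarrow> (\<exists>w\<ge>0. \<forall>j<m. r j = 0 \<or> r j = w)"

definition admissible :: "nat \<Rightarrow> nat \<Rightarrow> bids \<Rightarrow> bool" where
  "admissible n m b \<longleftrightarrow> (\<forall>i<n. admissible_bid m (b i))"

definition truthful_bids :: "(nat \<Rightarrow> real) \<Rightarrow> (nat \<times> nat) set \<Rightarrow> bids" where
  "truthful_bids v E i j = (if (i, j) \<in> E then v i else 0)"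

text \<open>Entry \<open>j\<close> of the history lists the bids of all \<open>n\<close> buyers on item \<open>j\<close>, for the first \<open>k\<close> items.\<close>

definition history :: "nat \<Rightarrow> nat \<Rightarrow> bids \<Rightarrow> real list list" where
  "history n k b = map (\<lambda>j. map (\<lambda>i. b i j) [0..<n]) [0..<k]"

text \<open>
  The fields get the number \<open>n\<close> of buyers as first argument. The whole randomness of the mechanism
  is one sample \<open>\<omega>\<close> from \<open>coins n\<close>. The decision on an item is \<open>alloc n \<omega> h\<close>, where \<open>h\<close> is the
  history up to and including this item; hence it depends neither on later bids nor on the number
  of items. Earlier decisions are determined by \<open>\<omega>\<close> and prefixes of \<open>h\<close>. The payment of buyer \<open>i\<close>
  is \<open>pay n \<omega> h i\<close>, where \<open>h\<close> is the history of the whole process, so that payments are tardy;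
  payments fixed earlier are a special case.
\<close>

record 'w mechanism =
  coins :: "nat \<Rightarrow> 'w measure"
  alloc :: "nat \<Rightarrow> 'w \<Rightarrow> real list list \<Rightarrow> nat option"
  pay :: "nat \<Rightarrow> 'w \<Rightarrow> real list list \<Rightarrow> nat \<Rightarrow> real"

definition outcome :: "'w mechanism \<Rightarrow> nat \<Rightarrow> nat \<Rightarrow> bids \<Rightarrow> 'w \<Rightarrow> assignment" where
  "outcome M n m b \<omega> j = (if j < m then alloc M n \<omega> (history n (Suc j) b) else None)"

definition payment :: "'w mechanism \<Rightarrow> nat \<Rightarrow> nat \<Rightarrow> bids \<Rightarrow> 'w \<Rightarrow> nat \<Rightarrow> real" where
  "payment M n m b \<omega> i = pay M n \<omega> (history n m b) i"

definition is_mechanism :: "'w mechanism \<Rightarrow> bool" where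
  "is_mechanism M \<longleftrightarrow>
     (\<forall>n. prob_space (coins M n)) \<and>
     (\<forall>n m b. admissible n m b \<longrightarrow>
        (\<forall>j<m. (\<lambda>\<omega>. outcome M n m b \<omega> j) \<in> measurable (coins M n) (count_space UNIV)) \<and>
        (\<forall>i<n. (\<lambda>\<omega>. payment M n m b \<omega> i) \<in> borel_measurable (coins M n)) \<and>
        (\<forall>\<omega>\<in>space (coins M n).
           (\<forall>j i. outcome M n m b \<omega> j = Some i \<longrightarrow>
              i < n \<and> b i j \<noteq> 0 \<and> (\<forall>j'<j. outcome M n m b \<omega> j' \<noteq> Some i)) \<and>
           (\<forall>i<n. 0 \<le> payment M n m b \<omega> i)))"

definition utility ::
    "'w mechanism \<Rightarrow> nat \<Rightarrow> nat \<Rightarrow> (nat \<Rightarrow> real) \<Rightarrow> (nat \<times> nat) set \<Rightarrow> bids \<Rightarrow> 'w \<Rightarrow> nat \<Rightarrow> real" where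
  "utility M n m v E b \<omega> i =
     v i * of_bool (satisfied E (outcome M n m b \<omega>) i) - payment M n m b \<omega> i"

definition ex_post_IR :: "'w mechanism \<Rightarrow> bool" where
  "ex_post_IR M \<longleftrightarrow>
     (\<forall>n m v E b i. is_instance n m v E \<longrightarrow> admissible n m b \<longrightarrow> i < n \<longrightarrow>
        b i = truthful_bids v E i \<longrightarrow>
        (\<forall>\<omega>\<in>space (coins M n). 0 \<le> utility M n m v E b \<omega> i))"

text \<open>
  The others' bids in \<open>b\<close> are arbitrary. For a mechanism that satisfies \<^const>\<open>ex_post_IR\<close>, the
  expected utilities below are integrals of bounded functions: every admissible report \<open>r\<close> is the
  truthful one for some valuation and interests, so the payment never exceeds the reported value.
\<close>

definition ex_ante_truthful :: "'w mechanism \<Rightarrow> bool" where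
  "ex_ante_truthful M \<longleftrightarrow>
     (\<forall>n m v E b i r. is_instance n m v E \<longrightarrow> admissible n m b \<longrightarrow> i < n \<longrightarrow>
        admissible_bid m r \<longrightarrow>
        (\<integral>\<omega>. utility M n m v E (b(i := r)) \<omega> i \<partial>coins M n)
          \<le> (\<integral>\<omega>. utility M n m v E (b(i := truthful_bids v E i)) \<omega> i \<partial>coins M n))"

definition yields_approximation :: "real \<Rightarrow> 'w mechanism \<Rightarrow> bool" where
  "yields_approximation \<alpha> M \<longleftrightarrow>
     (\<forall>n m v E. is_instance n m v E \<longrightarrow>
        opt n v E \<le> \<alpha> * (\<integral>\<omega>. welfare n v E (outcome M n m (truthful_bids v E) \<omega>) \<partial>coins M n))"

end

theory Submission imports Defs begin

text \<open>
  Let all \<open>n\<close> buyers be interested in all \<open>n\<close> items. For one buyer with value \<open>v\<close>, the other bids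
  being fixed, let \<open>x v\<close> be the probability that she gets the first item, \<open>y v\<close> the probability that
  she gets a later one, and \<open>D v\<close> the difference of her utilities when interested in all items and
  when interested in the first item only. By the envelope formula \<open>D\<close> is the integral of \<open>y\<close>; and a
  buyer who wants the first item only may pretend to want all, which yields \<open>D v \<le> v * y v\<close>. So
  \<open>D v / v\<close> increases and is at most \<open>y v \<le> 1 - x v\<close> for huge \<open>v\<close>. There \<open>x v\<close> is almost at least
  \<open>1 / \<alpha>\<close>, as the process may stop after the first item. Hence on average over bounded values a buyer
  gets a later item with probability at most \<open>1 - 1 / \<alpha>\<close>. The first item serves one buyer only, so
  for large \<open>n\<close> the mechanism obtains about a fraction \<open>1 - 1 / \<alpha>\<close> of the optimum, and this is at
  least \<open>1 / \<alpha>\<close> only if \<open>\<alpha> \<ge> 2\<close>. The average over \<open>v\<close> needs the weight of value \<open>v\<close> in the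
  welfare to be constant, that is, values distributed with probability proportional to \<open>1 / v\<close>.
\<close>

text \<open>Unit steps replace the envelope integral, at the price of the increments of
  \<open>x\<close>. These telescope to at most 1 on \<open>1..N\<close> and again on
  \<open>N..H\<close>; together with \<open>y N \<le> 1\<close> this gives the additive 3.\<close>

lemma sum_le_of_discrete_envelope:
  fixes D x y :: "nat \<Rightarrow> real"
  assumes D0: "0 \<le> D 1"
    and Dy: "\<And>v. D v \<le> real v * y v"
    and step: "\<And>v. D v + y v - (x (Suc v) - x v) \<le> D (Suc v)"
    and mono: "\<And>v. x v \<le> x (Suc v)"
    and x: "\<And>v. 0 \<le> x v" and y: "\<And>v. 0 \<le> y v" and xy: "\<And>v. x v + y v \<le> 1"
    and N: "1 \<le> N" "N \<le> H"
  shows "(\<Sum>v=1..N. y v) \<le> real N * (1 - x H) + 3"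
proof -
  have x1: "x v \<le> 1" and y1: "y v \<le> 1" for v
    using x[of v] y[of v] xy[of v] by linarith+
  have "(\<Sum>v=1..<k. y v) - (x k - x 1) \<le> D k" if "1 \<le> k" for k
    using that
  proof (induction k rule: dec_induct)
    case (step k)
    then show ?case using assms(3)[of k] by simp
  qed (use D0 in simp)
  from this[OF N(1)] have "(\<Sum>v=1..<N. y v) \<le> D N + 1"
    using x1[of N] x[of 1] by linarith
  moreover have "(\<Sum>v=1..N. y v) = (\<Sum>v=1..<N. y v) + y N"
    using N(1) by (simp add: atLeastLessThanSuc_atLeastAtMost[symmetric])
  ultimately have sum_le: "(\<Sum>v=1..N. y v) \<le> D N + 2"
    using y1[of N] by linarith
  \<comment> \<open>Since \<open>y k \<ge> D k / k\<close>, the envelope step multiplies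
    \<open>D k\<close> by at least \<open>1 + 1 / k\<close> up to the error, so
    \<open>D k / k\<close> is almost increasing. Dividing all errors by the same \<open>N\<close>
    lets them telescope.\<close>
  have "D N / real N - (x k - x N) / real N \<le> D k / real k" if "N \<le> k" for k
    using that
  proof (induction k rule: dec_induct)
    case (step k)
    have k: "0 < real k" "real N \<le> real k" "0 < real N" using N(1) step by linarith+
    have "D k / real k \<le> y k" using Dy[of k] k by (simp add: field_simps)
    then have "D k * (1 + 1 / real k) - (x (Suc k) - x k) \<le> D (Suc k)"
      using assms(3)[of k] by (simp add: distrib_left)
    moreover have "D k * (1 + 1 / real k) = (D k / real k) * real (Suc k)"
      using k by (simp add: field_simps)
    ultimately have "(D k / real k) * real (Suc k) - (x (Suc k) - x k) \<le> D (Suc k)"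
      by simp
    then have "((D k / real k) * real (Suc k) - (x (Suc k) - x k)) / real (Suc k)
        \<le> D (Suc k) / real (Suc k)"
      by (intro divide_right_mono) auto
    then have "D k / real k - (x (Suc k) - x k) / real (Suc k) \<le> D (Suc k) / real (Suc k)"
      by (simp add: diff_divide_distrib)
    moreover have "(x (Suc k) - x k) / real (Suc k) \<le> (x (Suc k) - x k) / real N"
      using mono[of k] k by (intro divide_left_mono) auto
    ultimately show ?case using step.IH by (simp add: diff_divide_distrib)
  qed simp
  from this[OF N(2)] have "D N / real N - (x H - x N) / real N \<le> D H / real H" .
  moreover have "D H / real H \<le> y H" using Dy[of H] N by (simp add: field_simps)
  ultimately have "D N / real N - (x H - x N) / real N \<le> 1 - x H" using xy[of H] by linarith
  then have "D N - (x H - x N) \<le> real N * (1 - x H)"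
    using N(1) by (simp add: field_simps)
  then show ?thesis using sum_le x1[of H] x[of N] by linarith
qed

section \<open>Bids on a set of items and measurability of outcomes\<close>

definition bid_on :: "nat set \<Rightarrow> real \<Rightarrow> nat \<Rightarrow> real" where
  "bid_on T v j = (if j \<in> T then v else 0)"

lemma admissible_bid_on: "0 \<le> v \<Longrightarrow> admissible_bid m (bid_on T v)"
  by (auto simp: admissible_bid_def bid_on_def)

lemma truthful_bids_eq_bid_on: "truthful_bids v ({i} \<times> T) i = bid_on T (v i)"
  by (auto simp: truthful_bids_def bid_on_def)

text \<open>A decision sees neither later bids nor the number of items. Hence the decision on item 0
  stays the same when a buyer hides her interest in later items or when the process stops after that
  item.\<close>

lemma outcome_cong:
  assumes "\<And>k l. k < n \<Longrightarrow> l \<le> j \<Longrightarrow> b k l = b' k l" "j < m" "j < m'"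
  shows "outcome M n m b \<omega> j = outcome M n m' b' \<omega> j"
proof -
  have "history n (Suc j) b = history n (Suc j) b'"
    unfolding history_def using assms(1) by (auto intro!: map_cong)
  then show ?thesis using assms(2,3) by (simp add: outcome_def)
qed

lemma outcome_bid_nonzero:
  assumes "is_mechanism M" "admissible n m b" "\<omega> \<in> space (coins M n)"
    "outcome M n m b \<omega> j = Some i"
  shows "b i j \<noteq> 0"
  using assms unfolding is_mechanism_def by auto

text \<open>No item from \<open>m\<close> on is ever assigned, so a finite union suffices even for
  \<open>S = UNIV\<close>.\<close>

lemma sets_outcome:
  assumes "is_mechanism M" "admissible n m b"
  shows "{\<omega> \<in> space (coins M n). \<exists>j\<in>S. outcome M n m b \<omega> j = Some i} \<in> sets (coins M n)"
proof -
  have "{\<omega> \<in> space (coins M n). \<exists>j\<in>S. outcome M n m b \<omega> j = Some i}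
      = (\<Union>j\<in>S \<inter> {..<m}. (\<lambda>\<omega>. outcome M n m b \<omega> j) -` {Some i} \<inter> space (coins M n))"
    by (auto simp: outcome_def split: if_splits)
  also have "\<dots> \<in> sets (coins M n)"
    using assms unfolding is_mechanism_def
    by (intro sets.finite_UN) (auto intro!: measurable_sets[where A = "count_space UNIV"])
  finally show ?thesis .
qed

section \<open>Incentive constraints of one buyer, the other bids being fixed\<close>

locale single_buyer =
  fixes M :: "'w mechanism" and n m i :: nat and b :: bids
  assumes mechanism: "is_mechanism M" and IR: "ex_post_IR M" and truthful: "ex_ante_truthful M"
    and admissible: "admissible n m b" and buyer: "i < n" and item: "0 < m"
begin

definition report :: "real \<Rightarrow> nat set \<Rightarrow> bids" where
  "report v T = b(i := bid_on T v)"

text \<open>The reported set \<open>T\<close> and the set \<open>S\<close> of items that count are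
  kept apart, because a misreporting buyer still values only the items of her true interest.\<close>

definition win :: "real \<Rightarrow> nat set \<Rightarrow> nat set \<Rightarrow> real" where
  "win v T S = measure (coins M n)
     {\<omega> \<in> space (coins M n). \<exists>j\<in>S. outcome M n m (report v T) \<omega> j = Some i}"

definition cost :: "real \<Rightarrow> nat set \<Rightarrow> real" where
  "cost v T = (\<integral>\<omega>. payment M n m (report v T) \<omega> i \<partial>coins M n)"

sublocale prob_space "coins M n"
  using mechanism by (simp add: is_mechanism_def)

lemma admissible_report: "0 \<le> v \<Longrightarrow> admissible n m (report v T)"
  using admissible by (auto simp: admissible_def report_def admissible_bid_on)

lemma win_mono: "0 \<le> v \<Longrightarrow> S \<subseteq> S' \<Longrightarrow> win v T S \<le> win v T S'"
  unfolding win_def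
  by (intro finite_measure_mono sets_outcome mechanism admissible_report) auto

lemma win_nonneg: "0 \<le> win v T S" and win_le_1: "win v T S \<le> 1"
  by (simp_all add: win_def)

text \<open>Every report is truthful for the type with value \<open>v\<close> and interests
  \<open>T\<close>, so individual rationality bounds the payment by \<open>v\<close>. Integrability
  allows splitting expected utility into value and payment.\<close>

lemma integrable_payment:
  assumes "0 \<le> v" "T \<subseteq> {..<m}"
  shows "integrable (coins M n) (\<lambda>\<omega>. payment M n m (report v T) \<omega> i)"
proof (rule integrable_const_bound[where B = v])
  have adm: "admissible n m (report v T)" using assms(1) by (rule admissible_report)
  show "(\<lambda>\<omega>. payment M n m (report v T) \<omega> i) \<in> borel_measurable (coins M n)"
    using mechanism adm buyer by (simp add: is_mechanism_def)
  have "is_instance n m (\<lambda>_. v) ({i} \<times> T)"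
    using assms buyer by (auto simp: is_instance_def)
  moreover have "report v T i = truthful_bids (\<lambda>_. v) ({i} \<times> T) i"
    by (simp add: report_def truthful_bids_eq_bid_on)
  ultimately have "0 \<le> utility M n m (\<lambda>_. v) ({i} \<times> T) (report v T) \<omega> i"
    if "\<omega> \<in> space (coins M n)" for \<omega>
    using IR adm buyer that unfolding ex_post_IR_def by blast
  moreover have "0 \<le> payment M n m (report v T) \<omega> i" if "\<omega> \<in> space (coins M n)" for \<omega>
    using mechanism adm buyer that by (simp add: is_mechanism_def)
  ultimately show "AE \<omega> in coins M n. norm (payment M n m (report v T) \<omega> i) \<le> v"
    using assms(1) by (intro AE_I2) (fastforce simp: utility_def of_bool_def split: if_splits)
qed

lemma expected_utility:
  assumes "0 \<le> v" "T \<subseteq> {..<m}"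
  shows "(\<integral>\<omega>. utility M n m u ({i} \<times> S) (report v T) \<omega> i \<partial>coins M n)
    = u i * win v T S - cost v T"
proof -
  let ?A = "{\<omega> \<in> space (coins M n). \<exists>j\<in>S. outcome M n m (report v T) \<omega> j = Some i}"
  have A: "?A \<in> sets (coins M n)"
    using mechanism admissible_report[OF assms(1)] by (rule sets_outcome)
  have "(\<integral>\<omega>. utility M n m u ({i} \<times> S) (report v T) \<omega> i \<partial>coins M n)
      = (\<integral>\<omega>. u i * indicator ?A \<omega> - payment M n m (report v T) \<omega> i \<partial>coins M n)"
    by (intro Bochner_Integration.integral_cong)
       (auto simp: utility_def satisfied_def indicator_def)
  also have "\<dots> = u i * win v T S - cost v T"
    using A integrable_payment[OF assms]
    by (subst Bochner_Integration.integral_diff)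
       (auto simp: win_def cost_def less_top[symmetric] Int_absorb2 subset_eq)
  finally show ?thesis .
qed

lemma report_truthful_optimal:
  assumes "0 \<le> v" "0 \<le> w" "T \<subseteq> {..<m}" "S \<subseteq> {..<m}"
  shows "w * win v T S - cost v T \<le> w * win w S S - cost w S"
proof -
  have "is_instance n m (\<lambda>_. w) ({i} \<times> S)"
    using assms buyer by (auto simp: is_instance_def)
  then have "(\<integral>\<omega>. utility M n m (\<lambda>_. w) ({i} \<times> S) (report v T) \<omega> i \<partial>coins M n)
      \<le> (\<integral>\<omega>. utility M n m (\<lambda>_. w) ({i} \<times> S) (report w S) \<omega> i \<partial>coins M n)"
    using truthful admissible buyer admissible_bid_on[OF assms(1), of m T]
    unfolding ex_ante_truthful_def report_def
    by (metis truthful_bids_eq_bid_on)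
  then show ?thesis using assms by (simp add: expected_utility)
qed

abbreviation first :: "real \<Rightarrow> real" where
  "first v \<equiv> win v {..<m} {0}"

abbreviation later :: "real \<Rightarrow> real" where
  "later v \<equiv> win v {..<m} {..<m} - win v {..<m} {0}"

text \<open>Both reports place the same bid on item 0 and can differ only after it is
  decided.\<close>

lemma win_first_only: "win v {0} {0} = first v"
proof -
  have "outcome M n m (report v {0}) \<omega> 0 = outcome M n m (report v {..<m}) \<omega> 0" for \<omega>
    by (rule outcome_cong) (use item in \<open>auto simp: report_def bid_on_def\<close>)
  then show ?thesis by (simp add: win_def)
qed

text \<open>For a buyer interested in item 0 only, adding the two constraints between values
  \<open>v\<close> and \<open>w\<close> cancels the payments.\<close>

lemma first_mono:
  assumes "0 \<le> v" "v < w"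
  shows "first v \<le> first w"
proof -
  have "v * first w - cost w {0} \<le> v * first v - cost v {0}"
    and "w * first v - cost v {0} \<le> w * first w - cost w {0}"
    using report_truthful_optimal[of w v "{0}" "{0}"] report_truthful_optimal[of v w "{0}" "{0}"]
      assms item by (simp_all add: win_first_only)
  then have "0 \<le> (w - v) * (first w - first v)" by (simp add: algebra_simps)
  then show ?thesis using assms by (simp add: zero_le_mult_iff)
qed

lemma sum_later_le:
  assumes "1 \<le> N" "N \<le> H"
  shows "(\<Sum>v=1..N. later (real v)) \<le> real N * (1 - first (real H)) + 3"
proof -
  define D where "D v = (v * win v {..<m} {..<m} - cost v {..<m}) - (v * first v - cost v {0})" for v
  \<comment> \<open>A buyer who wants all items may report interest in the first only.\<close>
  have D_nonneg: "0 \<le> D v" if "0 \<le> v" for v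
  proof -
    have "v * win v {0} {..<m} - cost v {0} \<le> v * win v {..<m} {..<m} - cost v {..<m}"
      using that item by (intro report_truthful_optimal) auto
    moreover have "v * first v \<le> v * win v {0} {..<m}"
      unfolding win_first_only[symmetric] using that item by (intro mult_left_mono win_mono) auto
    ultimately show ?thesis by (simp add: D_def)
  qed
  \<comment> \<open>Pretending to want all items keeps the chance of the first one, so the full
    report cannot cost less than the report \<open>{0}\<close>.\<close>
  have D_le: "D v \<le> v * later v" if "0 \<le> v" for v
    using report_truthful_optimal[of v v "{..<m}" "{0}"] that item
    by (simp add: D_def win_first_only algebra_simps)
  \<comment> \<open>From \<open>v\<close> to \<open>v + 1\<close>, the utility for all items rises
    by at least the winning probability at \<open>v\<close>, that for the first item by at most
    \<open>first (v + 1)\<close>.\<close>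
  have D_step: "D v + later v - (first (v + 1) - first v) \<le> D (v + 1)" if "0 \<le> v" for v
    using report_truthful_optimal[of v "v + 1" "{..<m}" "{..<m}"]
      report_truthful_optimal[of "v + 1" v "{0}" "{0}"] that item
    by (simp add: D_def win_first_only algebra_simps)
  show ?thesis
  proof (rule sum_le_of_discrete_envelope
      [where D = "\<lambda>v. D (real v)" and x = "\<lambda>v. first (real v)" and y = "\<lambda>v. later (real v)"])
    show "D (real v) + later (real v) - (first (real (Suc v)) - first (real v)) \<le> D (real (Suc v))"
      for v using D_step[of "real v"] by (simp add: add.commute)
    show "0 \<le> later (real v)" for v using win_mono[of "real v" "{0}" "{..<m}"] item by simp
    show "first (real v) + later (real v) \<le> 1" for v by (simp add: win_le_1)
  qed (use assms D_nonneg[of 1] D_le first_mono win_nonneg in auto)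
qed

end

text \<open>Fixing all coordinates but \<open>i\<close> leaves the one-parameter family of values
  that the single-buyer bound controls.\<close>

lemma sum_PiE_split:
  fixes F :: "('a \<Rightarrow> 'b) \<Rightarrow> 'c::comm_monoid_add"
  assumes "i \<in> I"
  shows "(\<Sum>f\<in>PiE I (\<lambda>_. A). F f) = (\<Sum>f\<in>PiE (I - {i}) (\<lambda>_. A). \<Sum>v\<in>A. F (f(i := v)))"
proof -
  have "(\<Sum>f\<in>PiE I (\<lambda>_. A). F f) = (\<Sum>f\<in>PiE (insert i (I - {i})) (\<lambda>_. A). F f)"
    using assms by (simp add: insert_absorb)
  also have "\<dots> = (\<Sum>(v, f)\<in>A \<times> PiE (I - {i}) (\<lambda>_. A). F (f(i := v)))"
    unfolding PiE_insert_eq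
    by (subst sum.reindex[OF inj_combinator]) (auto intro!: sum.cong)
  also have "\<dots> = (\<Sum>f\<in>PiE (I - {i}) (\<lambda>_. A). \<Sum>v\<in>A. F (f(i := v)))"
    by (subst sum.cartesian_product[symmetric]) (rule sum.swap)
  finally show ?thesis .
qed

section \<open>Expected welfare, the optimum and the first item\<close>

lemma admissible_truthful_bids:
  "is_instance n m v E \<Longrightarrow> admissible n m (truthful_bids v E)"
  by (auto simp: admissible_def admissible_bid_def truthful_bids_def is_instance_def)

lemma welfare_le_opt: "finite E \<Longrightarrow> \<mu> \<in> matchings E \<Longrightarrow> welfare n v E \<mu> \<le> opt n v E"
  unfolding opt_def by (intro Max_ge) (auto intro: finite_matchings)

lemma expected_welfare:
  assumes "is_mechanism M" "is_instance n m v E"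
  shows "(\<integral>\<omega>. welfare n v E (outcome M n m (truthful_bids v E) \<omega>) \<partial>coins M n)
    = (\<Sum>i<n. v i * measure (coins M n)
        {\<omega> \<in> space (coins M n). \<exists>j. outcome M n m (truthful_bids v E) \<omega> j = Some i})"
proof -
  interpret prob_space "coins M n" using assms(1) by (simp add: is_mechanism_def)
  let ?b = "truthful_bids v E"
  let ?A = "\<lambda>i. {\<omega> \<in> space (coins M n). \<exists>j. outcome M n m ?b \<omega> j = Some i}"
  have adm: "admissible n m ?b" using assms(2) by (rule admissible_truthful_bids)
  have A: "?A i \<in> sets (coins M n)" for i
    using sets_outcome[OF assms(1) adm, where S = UNIV] by simp
  \<comment> \<open>Items go only to nonzero bids, and truthful bids vanish off \<open>E\<close>; so
    receiving any item means receiving a desired one.\<close>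
  have sat: "satisfied E (outcome M n m ?b \<omega>) i \<longleftrightarrow> \<omega> \<in> ?A i" if "\<omega> \<in> space (coins M n)" for i \<omega>
    using that outcome_bid_nonzero[OF assms(1) adm that]
    unfolding satisfied_def truthful_bids_def mem_Collect_eq by meson
  have "(\<integral>\<omega>. welfare n v E (outcome M n m ?b \<omega>) \<partial>coins M n)
      = (\<integral>\<omega>. (\<Sum>i<n. v i * indicator (?A i) \<omega>) \<partial>coins M n)"
    unfolding welfare_def
    by (intro Bochner_Integration.integral_cong refl sum.cong)
       (simp_all only: sat indicator_def of_bool_def)
  also have "\<dots> = (\<Sum>i<n. v i * measure (coins M n) (?A i))"
    using A by (subst Bochner_Integration.integral_sum)
      (auto simp: less_top[symmetric] Int_absorb2 subset_eq)
  finally show ?thesis .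
qed

lemma sum_prob_item_le_1:
  assumes "is_mechanism M" "admissible n m b"
  shows "(\<Sum>i<n. measure (coins M n) {\<omega> \<in> space (coins M n). outcome M n m b \<omega> j = Some i}) \<le> 1"
proof -
  interpret prob_space "coins M n" using assms(1) by (simp add: is_mechanism_def)
  let ?A = "\<lambda>i. {\<omega> \<in> space (coins M n). outcome M n m b \<omega> j = Some i}"
  have "?A i \<in> events" for i using sets_outcome[OF assms, where S = "{j}"] by simp
  then have "(\<Sum>i<n. prob (?A i)) = prob (\<Union>i<n. ?A i)"
    by (intro finite_measure_finite_Union[symmetric]) (auto simp: disjoint_family_on_def)
  then show ?thesis by simp
qed

text \<open>If item 0 is the only one, the optimum is at least \<open>v i\<close>. One item serves
  one buyer, so the others add at most \<open>c\<close> to the expected welfare; the decision is the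
  same when more items follow.\<close>

lemma first_item_bound:
  assumes "is_mechanism M" "yields_approximation \<alpha> M" "0 < \<alpha>" "\<And>k. k < n \<Longrightarrow> 0 \<le> v k"
    "\<And>k. k < n \<Longrightarrow> k \<noteq> i \<Longrightarrow> v k \<le> c" "i < n" "0 \<le> c" "0 < m"
  shows "v i / \<alpha> \<le> v i * measure (coins M n) {\<omega> \<in> space (coins M n).
           outcome M n m (truthful_bids v ({..<n} \<times> {..<m})) \<omega> 0 = Some i} + c"
proof -
  let ?E = "{..<n} \<times> {..<1::nat}"
  let ?b = "truthful_bids v ?E"
  let ?p = "\<lambda>k. measure (coins M n) {\<omega> \<in> space (coins M n). outcome M n 1 ?b \<omega> 0 = Some k}"
  have inst: "is_instance n 1 v ?E" using assms by (auto simp: is_instance_def)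
  let ?\<mu> = "(\<lambda>_. None)(0 := Some i) :: assignment"
  have "v i = (\<Sum>k<n. if k = i then v i else 0)" using assms by simp
  also have "\<dots> \<le> welfare n v ?E ?\<mu>"
    unfolding welfare_def by (intro sum_mono) (use assms in \<open>auto simp: satisfied_def\<close>)
  also have "\<dots> \<le> opt n v ?E"
    by (rule welfare_le_opt) (use assms in \<open>auto simp: matchings_def split: if_splits\<close>)
  also have "\<dots> \<le> \<alpha> * (\<Sum>k<n. v k * ?p k)"
  proof -
    have "(\<exists>j. outcome M n 1 ?b \<omega> j = Some k) \<longleftrightarrow> outcome M n 1 ?b \<omega> 0 = Some k" for \<omega> k
      by (auto simp: outcome_def split: if_splits)
    then have "(\<integral>\<omega>. welfare n v ?E (outcome M n 1 ?b \<omega>) \<partial>coins M n) = (\<Sum>k<n. v k * ?p k)"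
      unfolding expected_welfare[OF assms(1) inst] by (simp only:)
    then show ?thesis
      using assms(2) inst unfolding yields_approximation_def by metis
  qed
  finally have "v i / \<alpha> \<le> (\<Sum>k<n. v k * ?p k)" using assms by (simp add: field_simps)
  also have "\<dots> = v i * ?p i + (\<Sum>k\<in>{..<n} - {i}. v k * ?p k)"
    using assms by (intro sum.remove) auto
  also have "(\<Sum>k\<in>{..<n} - {i}. v k * ?p k) \<le> (\<Sum>k\<in>{..<n} - {i}. c * ?p k)"
    using assms by (intro sum_mono mult_right_mono) auto
  also have "\<dots> \<le> (\<Sum>k<n. c * ?p k)" using assms by (intro sum_mono2) auto
  also have "\<dots> \<le> c"
    using sum_prob_item_le_1[OF assms(1) admissible_truthful_bids[OF inst]] assms(7)
    unfolding sum_distrib_left[symmetric] by (intro mult_left_le) auto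
  finally have "v i / \<alpha> \<le> v i * ?p i + c" by simp
  moreover have "outcome M n 1 ?b \<omega> 0 = outcome M n m (truthful_bids v ({..<n} \<times> {..<m})) \<omega> 0" for \<omega>
    by (rule outcome_cong) (use assms in \<open>auto simp: truthful_bids_def\<close>)
  ultimately show ?thesis by simp
qed

text \<open>Weight \<open>f\<close> by the product of all \<open>1 / f k\<close>. The factor
  \<open>f i\<close> cancels the weight of coordinate \<open>i\<close>, which leaves the plain sum
  of \<open>lower\<close> for fixed other values; \<open>upper\<close> bounds the same weighted
  total from above. The total weight cancels at the end.\<close>

lemma harmonic_average:
  fixes g :: "'a \<Rightarrow> ('a \<Rightarrow> nat) \<Rightarrow> real"
  assumes I: "finite I" and N: "1 \<le> N" and c: "0 \<le> c"
    and lower: "\<And>i f. i \<in> I \<Longrightarrow> f \<in> PiE (I - {i}) (\<lambda>_. {1..N}) \<Longrightarrow> c \<le> (\<Sum>v=1..N. g i (f(i := v)))"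
    and upper: "\<And>f. f \<in> PiE I (\<lambda>_. {1..N}) \<Longrightarrow> (\<Sum>i\<in>I. real (f i) * g i f) \<le> C"
  shows "real (card I) * c \<le> real N * C"
proof -
  let ?P = "\<lambda>J. PiE J (\<lambda>_. {1..N})"
  define w where "w J f = (\<Prod>k\<in>J. 1 / real (f k))" for J and f :: "'a \<Rightarrow> nat"
  define W where "W J = (\<Sum>f\<in>?P J. w J f)" for J
  have w_pos: "0 < w J f" if "f \<in> ?P J" for J f
    unfolding w_def using that by (intro prod_pos) (force simp: PiE_iff)
  have w_nonneg: "0 \<le> w J f" for J f unfolding w_def by (intro prod_nonneg) auto
  have W_pos: "0 < W I"
    unfolding W_def using I N w_pos by (intro sum_pos finite_PiE) (auto simp: PiE_eq_empty_iff)
  have w_upd: "w I (f(i := v)) = w (I - {i}) f / real v" if "i \<in> I" for i f v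
  proof -
    have "w I (f(i := v)) = 1 / real v * (\<Prod>k\<in>I - {i}. 1 / real ((f(i := v)) k))"
      unfolding w_def using I that by (simp add: prod.remove)
    also have "(\<Prod>k\<in>I - {i}. 1 / real ((f(i := v)) k)) = w (I - {i}) f"
      unfolding w_def by (intro prod.cong) auto
    finally show ?thesis by (simp del: fun_upd_apply)
  qed
  have W_le: "W I / real N \<le> W (I - {i})" if "i \<in> I" for i
  proof -
    have "W I = W (I - {i}) * (\<Sum>v=1..N. 1 / real v)"
      unfolding W_def sum_PiE_split[OF that] w_upd[OF that]
      by (simp add: sum_product)
    \<comment> \<open>The crude bound \<open>N\<close> on the harmonic sum suffices, as the number
      of buyers may be chosen large compared with \<open>N\<close>.\<close>
    also have "\<dots> \<le> W (I - {i}) * real N"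
      using sum_mono[of "{1..N}" "\<lambda>v. 1 / real v" "\<lambda>_. 1"]
      by (intro mult_left_mono) (auto simp: W_def intro!: sum_nonneg w_nonneg)
    finally show ?thesis using N by (simp add: field_simps)
  qed
  have "real (card I) * c * (W I / real N) = (\<Sum>i\<in>I. W I / real N * c)" by simp
  also have "\<dots> \<le> (\<Sum>i\<in>I. W (I - {i}) * c)"
    using c W_le by (intro sum_mono mult_right_mono)
  also have "\<dots> \<le> (\<Sum>i\<in>I. \<Sum>f\<in>?P I. w I f * (real (f i) * g i f))"
  proof (rule sum_mono)
    fix i assume i: "i \<in> I"
    have "W (I - {i}) * c \<le> (\<Sum>f\<in>?P (I - {i}). w (I - {i}) f * (\<Sum>v=1..N. g i (f(i := v))))"
      unfolding W_def sum_distrib_right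
      by (intro sum_mono mult_left_mono lower i w_nonneg)
    also have "\<dots> = (\<Sum>f\<in>?P I. w I f * (real (f i) * g i f))"
      unfolding sum_PiE_split[OF i] w_upd[OF i] sum_distrib_left
      by (intro sum.cong) auto
    finally show "W (I - {i}) * c \<le> (\<Sum>f\<in>?P I. w I f * (real (f i) * g i f))" .
  qed
  also have "\<dots> = (\<Sum>f\<in>?P I. w I f * (\<Sum>i\<in>I. real (f i) * g i f))"
    by (subst sum.swap) (simp add: sum_distrib_left)
  also have "\<dots> \<le> (\<Sum>f\<in>?P I. w I f * C)"
    by (intro sum_mono mult_left_mono upper w_nonneg)
  also have "\<dots> = C * W I" by (simp add: W_def sum_distrib_left mult.commute)
  finally have "(real (card I) * c) * W I \<le> (real N * C) * W I"
    using N by (simp add: field_simps)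
  then show ?thesis using W_pos by simp
qed

text \<open>Welfare is nonnegative, so \<alpha> \<le> 0 fails already for one buyer of value 1 and
  one item. Later steps divide by \<alpha>.\<close>

lemma approximation_ratio_pos:
  assumes "is_mechanism M" "yields_approximation \<alpha> M"
  shows "0 < \<alpha>"
proof (rule ccontr)
  assume "\<not> 0 < \<alpha>"
  let ?E = "{(0::nat, 0::nat)}"
  let ?v = "\<lambda>_::nat. 1::real"
  have inst: "is_instance 1 1 ?v ?E" by (simp add: is_instance_def)
  have "welfare 1 ?v ?E ((\<lambda>_. None)(0 := Some 0)) \<le> opt 1 ?v ?E"
    by (rule welfare_le_opt) (auto simp: matchings_def split: if_splits)
  then have "1 \<le> opt 1 ?v ?E" by (simp add: welfare_def satisfied_def)
  also have "\<dots> \<le> \<alpha> * (\<integral>\<omega>. welfare 1 ?v ?E (outcome M 1 1 (truthful_bids ?v ?E) \<omega>) \<partial>coins M 1)"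
    using assms(2) inst unfolding yields_approximation_def by blast
  also have "\<dots> \<le> 0"
    using \<open>\<not> 0 < \<alpha>\<close>
    by (intro mult_nonpos_nonneg Bochner_Integration.integral_nonneg) (auto simp: welfare_def)
  finally show False by simp
qed

section \<open>Complete bipartite graphs with integer values\<close>

locale approximating_mechanism =
  fixes M :: "'w mechanism" and \<alpha> :: real
  assumes mechanism: "is_mechanism M" and IR: "ex_post_IR M" and truthful: "ex_ante_truthful M"
    and approximation: "yields_approximation \<alpha> M"
begin

definition complete_bids :: "nat \<Rightarrow> (nat \<Rightarrow> nat) \<Rightarrow> bids" where
  "complete_bids n f = truthful_bids (\<lambda>k. real (f k)) ({..<n} \<times> {..<n})"

definition prob_win :: "nat \<Rightarrow> (nat \<Rightarrow> nat) \<Rightarrow> nat \<Rightarrow> real" where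
  "prob_win n f i = measure (coins M n)
     {\<omega> \<in> space (coins M n). \<exists>j. outcome M n n (complete_bids n f) \<omega> j = Some i}"

definition prob_first :: "nat \<Rightarrow> (nat \<Rightarrow> nat) \<Rightarrow> nat \<Rightarrow> real" where
  "prob_first n f i = measure (coins M n)
     {\<omega> \<in> space (coins M n). outcome M n n (complete_bids n f) \<omega> 0 = Some i}"

lemma alpha_pos: "0 < \<alpha>"
  using mechanism approximation by (rule approximation_ratio_pos)

lemma is_instance_complete: "is_instance n n (\<lambda>k. real (f k)) ({..<n} \<times> {..<n})"
  by (simp add: is_instance_def)

lemma admissible_complete_bids: "admissible n n (complete_bids n f)"
  unfolding complete_bids_def by (rule admissible_truthful_bids[OF is_instance_complete])

text \<open>The diagonal matching serves every buyer, so the optimum is at least the sum of the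
  values. The first item contributes at most \<open>N\<close> to the expected welfare.\<close>

lemma complete_graph_bound:
  assumes "\<And>k. k < n \<Longrightarrow> f k \<le> N"
  shows "(\<Sum>i<n. real (f i) * (1 - \<alpha> * (prob_win n f i - prob_first n f i))) \<le> \<alpha> * real N"
proof -
  let ?E = "{..<n} \<times> {..<n}" and ?v = "\<lambda>k. real (f k)"
  let ?\<mu> = "\<lambda>j. if j < n then Some j else None"
  have "(\<Sum>i<n. ?v i) = welfare n ?v ?E ?\<mu>"
    unfolding welfare_def by (intro sum.cong) (auto simp: satisfied_def)
  also have "\<dots> \<le> opt n ?v ?E"
    by (rule welfare_le_opt) (auto simp: matchings_def split: if_splits)
  also have "\<dots> \<le> \<alpha> * (\<Sum>i<n. ?v i * prob_win n f i)"
    using approximation is_instance_complete[of n f]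
    unfolding yields_approximation_def prob_win_def complete_bids_def
      expected_welfare[OF mechanism is_instance_complete, symmetric] by blast
  finally have "(\<Sum>i<n. ?v i) - \<alpha> * (\<Sum>i<n. ?v i * prob_win n f i) \<le> 0" by simp
  moreover have "(\<Sum>i<n. ?v i * prob_first n f i) \<le> real N"
  proof -
    have "(\<Sum>i<n. ?v i * prob_first n f i) \<le> (\<Sum>i<n. real N * prob_first n f i)"
      using assms by (intro sum_mono mult_right_mono) (auto simp: prob_first_def)
    also have "\<dots> \<le> real N"
      using sum_prob_item_le_1[OF mechanism admissible_complete_bids]
      unfolding sum_distrib_left[symmetric] prob_first_def by (intro mult_left_le) auto
    finally show ?thesis .
  qed
  then have "\<alpha> * (\<Sum>i<n. ?v i * prob_first n f i) \<le> \<alpha> * real N"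
    using alpha_pos by simp
  moreover have "(\<Sum>i<n. ?v i * (1 - \<alpha> * (prob_win n f i - prob_first n f i)))
      = (\<Sum>i<n. ?v i) - \<alpha> * (\<Sum>i<n. ?v i * prob_win n f i) + \<alpha> * (\<Sum>i<n. ?v i * prob_first n f i)"
    by (simp add: sum_distrib_left sum_subtractf[symmetric] sum.distrib[symmetric] algebra_simps)
  ultimately show ?thesis by linarith
qed

lemma sum_prob_later_le:
  assumes "i < n" "1 \<le> N" "\<And>k. k < n \<Longrightarrow> k \<noteq> i \<Longrightarrow> f k \<le> N"
  shows "(\<Sum>v=1..N. prob_win n (f(i := v)) i - prob_first n (f(i := v)) i)
    \<le> real N * (1 - 1 / \<alpha>) + 4"
proof -
  interpret single_buyer M n n i "complete_bids n f"
    by unfold_locales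
       (use mechanism IR truthful admissible_complete_bids assms(1) in auto)
  have report: "report (real v) {..<n} = complete_bids n (f(i := v))" for v
    using assms(1)
    unfolding report_def unfolding complete_bids_def by (auto simp: fun_eq_iff truthful_bids_def bid_on_def)
  have first: "first (real v) = prob_first n (f(i := v)) i" for v
    by (simp add: win_def report prob_first_def)
  have "(\<exists>j\<in>{..<n}. outcome M n n b' \<omega> j = Some i) \<longleftrightarrow> (\<exists>j. outcome M n n b' \<omega> j = Some i)" for b' \<omega>
    by (auto simp: outcome_def split: if_splits)
  then have win: "win (real v) {..<n} {..<n} = prob_win n (f(i := v)) i" for v
    by (simp add: win_def report prob_win_def)
  \<comment> \<open>At value \<open>N * N\<close> the other values, at most \<open>N\<close>, are
    negligible: after division by \<open>N\<close> the first-item bound has error 1, which turns the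
    3 of the envelope bound into 4.\<close>
  define H where "H = N * N"
  have H: "N \<le> H" "real H = real N * real N" using assms(2) by (simp_all add: H_def)
  have "real H / \<alpha> \<le> real H * first (real H) + real N"
    using first_item_bound[OF mechanism approximation alpha_pos,
        of n "\<lambda>k. real ((f(i := H)) k)" i "real N" n] assms
    unfolding first prob_first_def unfolding complete_bids_def by auto
  then have "real N * (real N / \<alpha>) \<le> real N * (real N * first (real H) + 1)"
    by (simp add: H algebra_simps)
  then have "real N / \<alpha> \<le> real N * first (real H) + 1"
    using assms(2) by (subst (asm) mult_le_cancel_left_pos) auto
  moreover have "(\<Sum>v=1..N. later (real v)) \<le> real N * (1 - first (real H)) + 3"
    using assms(2) H(1) by (rule sum_later_le)
  ultimately show ?thesis by (simp add: first win algebra_simps)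
qed

lemma alpha_ge_2: "2 \<le> \<alpha>"
proof (rule ccontr)
  assume "\<not> 2 \<le> \<alpha>"
  then have \<alpha>: "0 < 2 - \<alpha>" by simp
  obtain N :: nat where N: "5 * \<alpha> / (2 - \<alpha>) < real N" using reals_Archimedean2 by blast
  have "0 < real N" using N alpha_pos \<alpha> by (smt (verit) divide_pos_pos)
  then have N1: "1 \<le> N" by simp
  \<comment> \<open>With this \<open>n\<close> the average gives
    \<open>n * c \<le> n * \<alpha>\<close>. Here \<open>c\<close> is \<open>N\<close> minus
    \<alpha> times the bound on the sum of later wins, and \<open>N\<close> was chosen to make it
    exceed \<alpha>.\<close>
  define n where "n = N * N"
  define c where "c = (2 - \<alpha>) * real N - 4 * \<alpha>"
  have c: "\<alpha> < c" using N \<alpha> by (simp add: c_def field_simps)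
  have "real (card {..<n}) * c \<le> real N * (\<alpha> * real N)"
  proof (rule harmonic_average
      [where g = "\<lambda>i f. 1 - \<alpha> * (prob_win n f i - prob_first n f i)"])
    fix i f assume "i \<in> {..<n}" and f: "f \<in> PiE ({..<n} - {i}) (\<lambda>_. {1..N})"
    then have "\<alpha> * (\<Sum>v=1..N. prob_win n (f(i := v)) i - prob_first n (f(i := v)) i)
        \<le> \<alpha> * (real N * (1 - 1 / \<alpha>) + 4)"
      using alpha_pos N1 by (intro mult_left_mono sum_prob_later_le) (auto simp: PiE_iff)
    also have "\<dots> = real N - c" using alpha_pos by (simp add: c_def field_simps)
    finally show "c \<le> (\<Sum>v=1..N. 1 - \<alpha> * (prob_win n (f(i := v)) i - prob_first n (f(i := v)) i))"
      by (simp add: sum_subtractf sum_distrib_left[symmetric])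
  next
    fix f assume "f \<in> PiE {..<n} (\<lambda>_. {1..N})"
    then show "(\<Sum>i<n. real (f i) * (1 - \<alpha> * (prob_win n f i - prob_first n f i))) \<le> \<alpha> * real N"
      by (intro complete_graph_bound) (auto simp: PiE_iff)
  qed (use N1 c alpha_pos in auto)
  then have "real n * c \<le> real n * \<alpha>" by (simp add: n_def algebra_simps)
  then show False using c N1 by (simp add: n_def)
qed

end

theorem theorem8:
  fixes \<alpha> :: real
  assumes "\<alpha> < 2"
  shows "\<not> (\<exists>M :: 'w mechanism. is_mechanism M \<and> ex_post_IR M \<and> ex_ante_truthful M \<and>
               yields_approximation \<alpha> M)"
  using approximating_mechanism.alpha_ge_2[OF approximating_mechanism.intro] assms
  by (metis not_le)

end
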